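(* Let $\{\lambda,\alpha,\beta\}$ be singular Björling data on an interval $I$, and let $X=X_{\lambda,\alpha,\beta}$ be the solution of the singular Björling problem, a maxface on a neighborhood of the trace of $\lambda$. Then $X$ has only shrinking singularities on the trace of $\lambda$ if and only if both of the following hold: (1) for all $t\in I$, $\alpha_3'(t)\lambda_1'(t)+\beta_3(t)\lambda_2'(t)=0$; (2) for all $t\in I$: $\beta_1(t)\beta_2'(t)-\beta_2(t)\beta_1'(t)\neq0$ when $\beta_3(t)\ne0$, and $\alpha_1'(t)\alpha_2''(t)-\alpha_2'(t)\alpha_1''(t)\ne0$ when $\alpha_3'(t)\neq0$. In particular, if (1) and (2) hold and the trace of $\lambda$ is compact and is a connected component of the set of singular points of $X$, then the trace of $\lambda$ consists of only generalized cone-like singular points of $X$.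
   Context: $\mathbb E_1^3$ is $\mathbb R^3$ with $\langle (a_1,b_1,c_1),(a_2,b_2,c_2)\rangle=a_1a_2+b_1b_2-c_1c_2$; $\mathbb C$ is identified with $\mathbb R^2$. Maxface: a map $X:\Omega\to\mathbb E_1^3$ on a domain $\Omega\subset\mathbb C$ is a maxface if there are a meromorphic function $g$ (the Gauss map) and a holomorphic 1-form $f\,dz$ on $\Omega$ such that $(1+|g|^2)^2|f|^2|dz|^2$ is a positive definite Riemannian metric on $\Omega$, $|g|$ is not identically $1$, the form $\Phi=\left(\tfrac12(1+g^2),\tfrac i2(1-g^2),-g\right)f\,dz$ satisfies $\mathrm{Re}\int_\gamma\Phi=0$ for all loops $\gamma$ in $\Omega$, and $X(p)=\mathrm{Re}\int_o^p\Phi$ up to translation. Singular points of $X$ are the points where $X$ is not an immersion (equivalently $|g|=1$). Singular Björling data: a triplet $\{\lambda,\alpha,\beta\}$ such that (1) $\lambda=(\lambda_1,\lambda_2):I\to\mathbb C$ is a smooth curve on an interval $I$ with $\lambda'(t)\ne0$ for all $t$; (2) $\alpha=(\alpha_1,\alpha_2,\alpha_3):I\to\mathbb E_1^3$ is a null curve ($\langle\alpha',\alpha'\rangle=0$) and $\beta=(\beta_1,\beta_2,\beta_3):I\to\mathbb E_1^3$ is a null vector field ($\langle\beta,\beta\rangle=0$) with $\langle\alpha'(t),\beta(t)\rangle=0$ for all $t$, and for each $t\in I$ at least one of $\alpha'(t),\beta(t)$ is nonzero; (3) the map $\phi(\lambda(t))=\alpha'(t)-i\beta(t)$ has an analytic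 extension $\phi(z)=(\phi_1,\phi_2,\phi_3)(z)$ to a neighborhood of the trace of $\lambda$; (4) the function on the trace of $\lambda$ given by $G(t)=\frac{\alpha_1'(t)+i\alpha_2'(t)}{\alpha_3'(t)}$ if $\alpha'(t)\neq0$ and $G(t)=\frac{\beta_1(t)+i\beta_2(t)}{\beta_3(t)}$ if $\beta_3(t)\ne0$ has an analytic extension whose modulus is not identically $1$. Solution of the singular Björling problem: it is assumed that $\mathrm{Re}\int_\gamma\phi(z)\,dz=0$ for all loops $\gamma$ in a neighborhood $\Omega$ of the trace of $\lambda$; the solution is $X_{\lambda,\alpha,\beta}(z)=\mathrm{Re}\int_{\lambda(t_0)}^z\phi(w)\,dw$, $z\in\Omega$, for a fixed $t_0\in I$. It is a maxface on a sufficiently small neighborhood of the trace of $\lambda$, with Gauss map $g=-\phi_3/(\phi_1-i\phi_2)$, and the trace of $\lambda$ consists of singular points. Shrinking singularities on the trace of $\lambda$: $X$ has (only) shrinking singularities on the trace of $\lambda$ if $X(\lambda(t))$ is constant in $t\in I$ and $g'(\lambda(t))\ne0$ for all $t\in I$. Generalized cone-like singular point: let $\Sigma_0$ be a connected component of the set of singular points of $X$. Each point of $\Sigma_0$ is called a generalized cone-like singular point if $\Sigma_0$ is compact and $X(\Sigma_0)$ is a single point. *)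

theory Defs
  imports "HOL-Complex_Analysis.Complex_Analysis"
begin

no_notation fps_nth (infixl "$" 75)

definition lorentz :: "real^3 \<Rightarrow> real^3 \<Rightarrow> real" where
  "lorentz a b = a $ 1 * b $ 1 + a $ 2 * b $ 2 - a $ 3 * b $ 3"

definition nbhd_domain :: "complex set \<Rightarrow> complex set \<Rightarrow> bool" where
  "nbhd_domain \<Omega> S \<longleftrightarrow> open \<Omega> \<and> connected \<Omega> \<and> S \<subseteq> \<Omega>"

definition holomorphic_vec_on :: "(complex \<Rightarrow> complex^3) \<Rightarrow> complex set \<Rightarrow> bool" where
  "holomorphic_vec_on \<phi> \<Omega> \<longleftrightarrow> (\<forall>k. (\<lambda>z. \<phi> z $ k) holomorphic_on \<Omega>)"

definition Re_integral :: "(real \<Rightarrow> complex) \<Rightarrow> (complex \<Rightarrow> complex^3) \<Rightarrow> real^3" where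
  "Re_integral \<gamma> \<phi> = (\<chi> k. Re (contour_integral \<gamma> (\<lambda>z. \<phi> z $ k)))"

definition no_real_periods :: "complex set \<Rightarrow> (complex \<Rightarrow> complex^3) \<Rightarrow> bool" where
  "no_real_periods \<Omega> \<phi> \<longleftrightarrow>
     (\<forall>\<gamma>. valid_path \<gamma> \<and> path_image \<gamma> \<subseteq> \<Omega> \<and> pathfinish \<gamma> = pathstart \<gamma> \<longrightarrow> Re_integral \<gamma> \<phi> = 0)"

text \<open>\<open>X z\<close> is the real part of the integral of \<open>\<phi>\<close> from \<open>p\<close> to \<open>z\<close>, along every path in \<open>\<Omega>\<close>.\<close>

definition is_Re_primitive ::
  "complex set \<Rightarrow> (complex \<Rightarrow> complex^3) \<Rightarrow> complex \<Rightarrow> (complex \<Rightarrow> real^3) \<Rightarrow> bool" where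
  "is_Re_primitive \<Omega> \<phi> p X \<longleftrightarrow>
     (\<forall>z\<in>\<Omega>. \<forall>\<gamma>. valid_path \<gamma> \<and> path_image \<gamma> \<subseteq> \<Omega> \<and> pathstart \<gamma> = p \<and> pathfinish \<gamma> = z
        \<longrightarrow> X z = Re_integral \<gamma> \<phi>)"

definition weierstrass_form ::
  "(complex \<Rightarrow> complex) \<Rightarrow> (complex \<Rightarrow> complex) \<Rightarrow> complex \<Rightarrow> complex^3" where
  "weierstrass_form g f z =
     vector [(1 + (g z)\<^sup>2) / 2 * f z, \<i> / 2 * (1 - (g z)\<^sup>2) * f z, - g z * f z]"

text \<open>
  \<open>X\<close> is a maxface on \<open>\<Omega>\<close> with Gauss map \<open>g\<close>. A nicely meromorphic \<open>g\<close> takes its limit as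
  value at every point that is not a pole, and the dummy value 0 at poles. Expressions in \<open>g\<close> are
  therefore meaningful at a pole only as limits: the density of the metric is required to have a
  finite positive limit at every point, and the Weierstrass form \<open>\<Phi>\<close> is the holomorphic
  extension across the poles. A finite limit of the density \<open>|f|\<^sup>2 + 2 |g f|\<^sup>2 + |g\<^sup>2 f|\<^sup>2\<close> forces
  \<open>g f\<close> and \<open>g\<^sup>2 f\<close> to extend holomorphically, so the metric is automatically smooth.
  As \<open>X\<close> determines \<open>\<Phi>\<close>, and \<open>f = \<Phi>\<^sub>1 - \<i> \<Phi>\<^sub>2\<close>, \<open>g = - \<Phi>\<^sub>3 / f\<close>, it also determines its Gauss map.
\<close>

definition maxface_on ::
  "complex set \<Rightarrow> (complex \<Rightarrow> real^3) \<Rightarrow> (complex \<Rightarrow> complex) \<Rightarrow> bool" where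
  "maxface_on \<Omega> X g \<longleftrightarrow>
     open \<Omega> \<and> connected \<Omega> \<and> \<Omega> \<noteq> {} \<and> g nicely_meromorphic_on \<Omega> \<and> (\<exists>z\<in>\<Omega>. cmod (g z) \<noteq> 1) \<and>
     (\<exists>f \<Phi>. f holomorphic_on \<Omega> \<and>
        (\<forall>p\<in>\<Omega>. \<exists>L>0. ((\<lambda>z. (1 + (cmod (g z))\<^sup>2)\<^sup>2 * (cmod (f z))\<^sup>2) \<longlongrightarrow> L) (at p)) \<and>
        holomorphic_vec_on \<Phi> \<Omega> \<and>
        (\<forall>z\<in>\<Omega>. \<not> is_pole g z \<longrightarrow> \<Phi> z = weierstrass_form g f z) \<and>
        no_real_periods \<Omega> \<Phi> \<and>
        (\<exists>p\<in>\<Omega>. \<exists>c. is_Re_primitive \<Omega> \<Phi> p (\<lambda>z. X z - c)))"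

definition singular_points :: "complex set \<Rightarrow> (complex \<Rightarrow> real^3) \<Rightarrow> complex set" where
  "singular_points \<Omega> X = {p\<in>\<Omega>. \<not> (\<exists>D. (X has_derivative D) (at p) \<and> inj D)}"

text \<open>Derivatives on an interval are taken within it, hence one-sided at endpoints belonging to it.\<close>

definition dcurve :: "real set \<Rightarrow> (real \<Rightarrow> 'a::real_normed_vector) \<Rightarrow> real \<Rightarrow> 'a" where
  "dcurve I \<gamma> t = vector_derivative \<gamma> (at t within I)"

definition smooth_curve_on :: "real set \<Rightarrow> (real \<Rightarrow> 'a::real_normed_vector) \<Rightarrow> bool" where
  "smooth_curve_on I \<gamma> \<longleftrightarrow>
     (\<exists>D. D 0 = \<gamma> \<and> (\<forall>n. \<forall>t\<in>I. (D n has_vector_derivative D (Suc n) t) (at t within I)))"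

definition extends_bjorling_data ::
  "real set \<Rightarrow> (real \<Rightarrow> complex) \<Rightarrow> (real \<Rightarrow> real^3) \<Rightarrow> (real \<Rightarrow> real^3) \<Rightarrow>
   complex set \<Rightarrow> (complex \<Rightarrow> complex^3) \<Rightarrow> bool" where
  "extends_bjorling_data I lam \<alpha> \<beta> \<Omega> \<phi> \<longleftrightarrow>
     nbhd_domain \<Omega> (lam ` I) \<and> holomorphic_vec_on \<phi> \<Omega> \<and>
     (\<forall>t\<in>I. \<forall>k. \<phi> (lam t) $ k =
        complex_of_real (dcurve I \<alpha> t $ k) - \<i> * complex_of_real (\<beta> t $ k))"

text \<open>
  The neighbourhood in the last condition is connected: otherwise a component not meeting the
  trace could witness that the modulus of the extension is not identically 1.
\<close>

definition singular_bjorling_data ::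
  "real set \<Rightarrow> (real \<Rightarrow> complex) \<Rightarrow> (real \<Rightarrow> real^3) \<Rightarrow> (real \<Rightarrow> real^3) \<Rightarrow> bool" where
  "singular_bjorling_data I lam \<alpha> \<beta> \<longleftrightarrow>
     is_interval I \<and> interior I \<noteq> {} \<and>
     smooth_curve_on I lam \<and> (\<forall>t\<in>I. dcurve I lam t \<noteq> 0) \<and>
     smooth_curve_on I \<alpha> \<and> smooth_curve_on I \<beta> \<and>
     (\<forall>t\<in>I. lorentz (dcurve I \<alpha> t) (dcurve I \<alpha> t) = 0 \<and> lorentz (\<beta> t) (\<beta> t) = 0 \<and>
        lorentz (dcurve I \<alpha> t) (\<beta> t) = 0 \<and> (dcurve I \<alpha> t \<noteq> 0 \<or> \<beta> t \<noteq> 0)) \<and>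
     (\<exists>\<Omega> \<phi>. extends_bjorling_data I lam \<alpha> \<beta> \<Omega> \<phi>) \<and>
     (\<exists>\<Omega> G. nbhd_domain \<Omega> (lam ` I) \<and> G holomorphic_on \<Omega> \<and> (\<exists>z\<in>\<Omega>. cmod (G z) \<noteq> 1) \<and>
        (\<forall>t\<in>I.
           (dcurve I \<alpha> t \<noteq> 0 \<longrightarrow>
              G (lam t) = Complex (dcurve I \<alpha> t $ 1) (dcurve I \<alpha> t $ 2) / of_real (dcurve I \<alpha> t $ 3)) \<and>
           (\<beta> t $ 3 \<noteq> 0 \<longrightarrow>
              G (lam t) = Complex (\<beta> t $ 1) (\<beta> t $ 2) / of_real (\<beta> t $ 3))))"

definition bjorling_solution ::
  "real set \<Rightarrow> (real \<Rightarrow> complex) \<Rightarrow> (real \<Rightarrow> real^3) \<Rightarrow> (real \<Rightarrow> real^3) \<Rightarrow>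
   complex set \<Rightarrow> (complex \<Rightarrow> complex^3) \<Rightarrow> real \<Rightarrow> (complex \<Rightarrow> real^3) \<Rightarrow> bool" where
  "bjorling_solution I lam \<alpha> \<beta> \<Omega> \<phi> t0 X \<longleftrightarrow>
     extends_bjorling_data I lam \<alpha> \<beta> \<Omega> \<phi> \<and> no_real_periods \<Omega> \<phi> \<and>
     t0 \<in> I \<and> is_Re_primitive \<Omega> \<phi> (lam t0) X"

definition shrinking_on_trace ::
  "real set \<Rightarrow> (real \<Rightarrow> complex) \<Rightarrow> (complex \<Rightarrow> real^3) \<Rightarrow> (complex \<Rightarrow> complex) \<Rightarrow> bool" where
  "shrinking_on_trace I lam X g \<longleftrightarrow>
     (\<exists>c. \<forall>t\<in>I. X (lam t) = c) \<and> (\<forall>t\<in>I. deriv g (lam t) \<noteq> 0)"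

definition generalized_cone_like ::
  "complex set \<Rightarrow> (complex \<Rightarrow> real^3) \<Rightarrow> complex \<Rightarrow> bool" where
  "generalized_cone_like \<Omega> X p \<longleftrightarrow>
     (\<exists>\<Sigma>0 \<in> components (singular_points \<Omega> X). p \<in> \<Sigma>0 \<and> compact \<Sigma>0 \<and> (\<exists>c. X ` \<Sigma>0 = {c}))"

end

theory Submission
  imports Defs
begin

text \<open>
  At a parameter \<open>t\<close> the vectors \<open>\<alpha>'(t)\<close> and \<open>\<beta>(t)\<close> are null and orthogonal in Minkowski space,
  which forces them to be real multiples \<open>\<alpha>\<^sub>3' n\<close> and \<open>\<beta>\<^sub>3 n\<close> of one null vector
  \<open>n = (Re u, Im u, 1)\<close> with \<open>\<bar>u\<bar> = 1\<close> (lemma \<open>orthogonal_null_vectors_common_direction\<close>). Hence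
  \<open>\<phi>(\<lambda>(t)) = (\<alpha>\<^sub>3' - \<i> \<beta>\<^sub>3) n\<close> with a nonzero scalar factor, and both conditions of the criterion
  become statements about this factor and about the rotation of \<open>u\<close>.

  Along the trace the derivative of \<open>X(\<lambda>(t))\<close> is
  \<open>Re (\<phi>(\<lambda>(t)) \<lambda>'(t)) = (\<alpha>\<^sub>3' \<lambda>\<^sub>1' + \<beta>\<^sub>3 \<lambda>\<^sub>2') n\<close>, so its third component alone decides whether
  \<open>X\<close> is constant on the trace, and the first condition says that it vanishes.

  The Gauss map satisfies \<open>g = - \<phi>\<^sub>3 / (\<phi>\<^sub>1 - \<i> \<phi>\<^sub>2)\<close> wherever the denominator is nonzero
  (lemma \<open>maxface_gauss_map\<close>), since the surface determines its Weierstrass form. On the trace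
  this evaluates to \<open>g(\<lambda>(t)) = - u(t)\<close>. As \<open>u' = - g'(\<lambda>) \<lambda>'\<close> and \<open>\<lambda>' \<noteq> 0\<close>, the derivative of
  \<open>g\<close> is nonzero at \<open>\<lambda>(t)\<close> exactly when \<open>u'(t) \<noteq> 0\<close>. A unit complex number can only move
  perpendicularly to itself, so for a planar vector \<open>r u\<close> with real \<open>r \<noteq> 0\<close> the cross product with
  its derivative is \<open>r\<^sup>2\<close> times the signed speed of \<open>u\<close>
  (lemma \<open>rotating_vector_cross_nonzero_iff\<close>). With \<open>r = \<beta>\<^sub>3\<close> and \<open>r = \<alpha>\<^sub>3'\<close> this yields
  the cross-product condition, and because one of the two factors is nonzero at each \<open>t\<close>, it tests
  every point of the trace.
\<close>

section \<open>The real part of a holomorphic primitive\<close>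

text \<open>
  In a disc around \<open>z\<close> the form has a holomorphic primitive \<open>F\<close>. Extending a path to \<open>z\<close> by a
  segment shows that \<open>X\<close> differs from \<open>Re F\<close> by a constant there.
\<close>

lemma Re_primitive_has_derivative:
  assumes dom: "open \<Omega>" "connected \<Omega>" "p \<in> \<Omega>" and hol: "holomorphic_vec_on \<phi> \<Omega>"
    and prim: "is_Re_primitive \<Omega> \<phi> p X" and z: "z \<in> \<Omega>"
  shows "((\<lambda>w. X w $ k) has_derivative (\<lambda>h. Re (\<phi> z $ k * h))) (at z)"
proof -
  let ?f = "\<lambda>z. \<phi> z $ k"
  have f: "?f holomorphic_on \<Omega>"
    using hol by (simp add: holomorphic_vec_on_def)
  obtain r where r: "r > 0" "ball z r \<subseteq> \<Omega>"
    using dom z openE by blast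
  have "?f holomorphic_on ball z r"
    using f r holomorphic_on_subset by blast
  then obtain F where F: "\<And>w. w \<in> ball z r \<Longrightarrow> (F has_field_derivative ?f w) (at w within ball z r)"
    using holomorphic_convex_primitive'[OF convex_ball open_ball] by metis
  obtain \<gamma> where "polynomial_function \<gamma>"
    and \<gamma>: "path_image \<gamma> \<subseteq> \<Omega>" "pathstart \<gamma> = p" "pathfinish \<gamma> = z"
    using connected_open_polynomial_connected[OF dom(1,2,3) z] by blast
  then have val: "valid_path \<gamma>"
    by (simp add: valid_path_polynomial_function)
  have incr: "X w $ k = X z $ k + Re (F w - F z)" if w: "w \<in> ball z r" for w
  proof -
    let ?l = "linepath z w"
    have sub: "path_image ?l \<subseteq> ball z r"
      using w r by (simp add: closed_segment_subset)
    have int_l: "(?f has_contour_integral (F w - F z)) ?l"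
      using contour_integral_primitive[OF F valid_path_linepath sub] by simp
    have int_\<gamma>: "?f contour_integrable_on \<gamma>"
      using contour_integrable_holomorphic_simple[OF f dom(1) val \<gamma>(1)] .
    have "contour_integral (\<gamma> +++ ?l) ?f = contour_integral \<gamma> ?f + (F w - F z)"
      using int_l int_\<gamma> val
      by (metis contour_integrable_on_def contour_integral_join contour_integral_unique
          valid_path_linepath)
    moreover have "X w = Re_integral (\<gamma> +++ ?l) \<phi>"
    proof -
      have "valid_path (\<gamma> +++ ?l)" "path_image (\<gamma> +++ ?l) \<subseteq> \<Omega>"
        using val \<gamma> sub r by (auto intro: valid_path_join simp: path_image_join)
      then show ?thesis
        using prim w r \<gamma> unfolding is_Re_primitive_def
        by (metis pathfinish_join pathfinish_linepath pathstart_join subsetD)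
    qed
    moreover have "X z = Re_integral \<gamma> \<phi>"
      using prim z val \<gamma> unfolding is_Re_primitive_def by blast
    ultimately show ?thesis
      by (simp add: Re_integral_def)
  qed
  have "(F has_field_derivative ?f z) (at z)"
    using F[of z] r by (simp add: at_within_open[OF _ open_ball])
  then have "(F has_derivative (\<lambda>h. ?f z * h)) (at z)"
    by (simp add: has_field_derivative_def)
  then have "((\<lambda>w. Re (F w) + (X z $ k - Re (F z))) has_derivative (\<lambda>h. Re (?f z * h))) (at z)"
    by (intro has_derivative_add_const bounded_linear.has_derivative[OF bounded_linear_Re])
  then show ?thesis
  proof (rule has_derivative_transform_within_open)
    show "open (ball z r)" "z \<in> ball z r"
      using r by simp_all
    show "Re (F w) + (X z $ k - Re (F z)) = X w $ k" if "w \<in> ball z r" for w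
      using incr[OF that] by simp
  qed
qed

text \<open>
  A complex number is determined by the real linear map \<open>h \<mapsto> Re (a h)\<close>, so the differential of the
  surface determines the form. This identifies the form of the Bjoerling problem with the
  Weierstrass form of the maxface, although the two may use different base points.
\<close>

lemma Re_primitive_determines_form:
  assumes dom: "open \<Omega>" "connected \<Omega>" "p \<in> \<Omega>" "q \<in> \<Omega>"
    and hol: "holomorphic_vec_on \<phi> \<Omega>" "holomorphic_vec_on \<psi> \<Omega>"
    and prim: "is_Re_primitive \<Omega> \<phi> p X" "is_Re_primitive \<Omega> \<psi> q (\<lambda>z. X z - c)"
    and z: "z \<in> \<Omega>"
  shows "\<phi> z = \<psi> z"
proof -
  have "\<phi> z $ k = \<psi> z $ k" for k
  proof -
    have "((\<lambda>w. X w $ k) has_derivative (\<lambda>h. Re (\<phi> z $ k * h))) (at z)"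
      using Re_primitive_has_derivative[OF dom(1-3) hol(1) prim(1) z] .
    moreover have "((\<lambda>w. (X w - c) $ k + c $ k) has_derivative (\<lambda>h. Re (\<psi> z $ k * h))) (at z)"
      using has_derivative_add_const[OF
          Re_primitive_has_derivative[OF dom(1,2,4) hol(2) prim(2) z]] .
    ultimately have "(\<lambda>h. Re (\<phi> z $ k * h)) = (\<lambda>h. Re (\<psi> z $ k * h))"
      by (simp add: has_derivative_unique)
    from fun_cong[OF this, of 1] fun_cong[OF this, of \<i>] show ?thesis
      by (simp add: complex_eq_iff)
  qed
  then show ?thesis
    by (simp add: vec_eq_iff)
qed

section \<open>The Gauss map\<close>

text \<open>
  Away from poles of \<open>g\<close> the Weierstrass form gives \<open>\<phi>\<^sub>1 - \<i> \<phi>\<^sub>2 = f\<close> and \<open>\<phi>\<^sub>3 = - g f\<close>, hence the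
  formula for \<open>g\<close>. Poles are isolated, so near \<open>p\<close> the Gauss map agrees with a quotient that is
  continuous at \<open>p\<close>; this excludes a pole at \<open>p\<close> itself.
\<close>

lemma maxface_gauss_map:
  assumes maxface: "maxface_on \<Omega> X g" and hol: "holomorphic_vec_on \<phi> \<Omega>"
    and prim: "is_Re_primitive \<Omega> \<phi> q X" "q \<in> \<Omega>"
    and p: "p \<in> \<Omega>" and nz: "\<phi> p $ 1 - \<i> * \<phi> p $ 2 \<noteq> 0"
  shows "g analytic_on {p}" "g p = - \<phi> p $ 3 / (\<phi> p $ 1 - \<i> * \<phi> p $ 2)"
proof -
  define F where "F z = \<phi> z $ 1 - \<i> * \<phi> z $ 2" for z
  define Q where "Q z = - \<phi> z $ 3 / F z" for z
  from maxface have dom: "open \<Omega>" "connected \<Omega>" and nice: "g nicely_meromorphic_on \<Omega>"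
    by (auto simp: maxface_on_def)
  from maxface obtain f \<Phi> o' c where \<Phi>: "holomorphic_vec_on \<Phi> \<Omega>" "o' \<in> \<Omega>"
      "is_Re_primitive \<Omega> \<Phi> o' (\<lambda>z. X z - c)"
    and weier: "\<And>z. z \<in> \<Omega> \<Longrightarrow> \<not> is_pole g z \<Longrightarrow> \<Phi> z = weierstrass_form g f z"
    unfolding maxface_on_def by blast
  have form: "\<phi> z = weierstrass_form g f z" if "z \<in> \<Omega>" "\<not> is_pole g z" for z
    using Re_primitive_determines_form[OF dom prim(2) \<Phi>(2) hol \<Phi>(1) prim(1) \<Phi>(3)] weier that
    by simp
  have g_eq: "g z = Q z" if "z \<in> \<Omega>" "\<not> is_pole g z" "F z \<noteq> 0" for z
  proof -
    have "F z = f z" "\<phi> z $ 3 = - g z * f z"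
      unfolding F_def form[OF that(1,2)] weierstrass_form_def
      by (simp_all add: field_simps)
    then show ?thesis
      using that(3) by (simp add: Q_def)
  qed
  have F_cont: "isCont F p" and \<phi>3_cont: "isCont (\<lambda>z. \<phi> z $ 3) p"
  proof -
    have comp: "isCont (\<lambda>z. \<phi> z $ k) p" for k
      using hol p dom(1) continuous_on_eq_continuous_at holomorphic_on_imp_continuous_on
      unfolding holomorphic_vec_on_def by blast
    show "isCont F p" "isCont (\<lambda>z. \<phi> z $ 3) p"
      unfolding F_def by (intro continuous_intros comp)+
  qed
  have Q_lim: "Q \<midarrow>p\<rightarrow> Q p"
  proof -
    have "F p \<noteq> 0"
      using nz by (simp add: F_def)
    then have "isCont Q p"
      unfolding Q_def[abs_def] using F_cont \<phi>3_cont by (simp add: isCont_divide)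
    then show ?thesis
      by (rule isContD)
  qed
  have "\<forall>\<^sub>F z in at p. \<not> is_pole g z"
    using nice p unfolding nicely_meromorphic_on_def
    by (intro eventually_not_pole meromorphic_on_isolated_singularity)
      (auto intro: meromorphic_on_subset)
  moreover have "\<forall>\<^sub>F z in at p. F z \<noteq> 0"
    by (rule tendsto_imp_eventually_ne[OF isContD[OF F_cont]]) (use nz in \<open>simp add: F_def\<close>)
  moreover have "\<forall>\<^sub>F z in at p. z \<in> \<Omega>"
    using dom p by (simp add: eventually_at_in_open')
  ultimately have ev: "\<forall>\<^sub>F z in at p. g z = Q z"
    by eventually_elim (rule g_eq)
  have "\<not> is_pole Q p"
    using Q_lim not_tendsto_and_filterlim_at_infinity[of "at p"] unfolding is_pole_def by auto
  then have not_pole: "\<not> is_pole g p"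
    using is_pole_cong[OF ev] by blast
  show "g analytic_on {p}"
    using nicely_meromorphic_on_imp_analytic_at[OF nice p not_pole] .
  show "g p = - \<phi> p $ 3 / (\<phi> p $ 1 - \<i> * \<phi> p $ 2)"
    using g_eq[OF p not_pole] nz by (simp add: F_def Q_def)
qed

section \<open>Null vectors and their rotation\<close>

text \<open>
  In signature \<open>(2, 1)\<close> a totally isotropic subspace has dimension at most one. Concretely, the
  squared Euclidean length
  of the planar part of \<open>b\<^sub>3 a - a\<^sub>3 b\<close> is a combination of the three vanishing products,
  and a null vector with third component zero vanishes.
\<close>

lemma orthogonal_null_vectors_common_direction:
  assumes "lorentz a a = 0" "lorentz b b = 0" "lorentz a b = 0" "a \<noteq> 0 \<or> b \<noteq> 0"
  obtains u where "cmod u = 1" "Complex (a $ 1) (a $ 2) = of_real (a $ 3) * u"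
    "Complex (b $ 1) (b $ 2) = of_real (b $ 3) * u" "a $ 3 \<noteq> 0 \<or> b $ 3 \<noteq> 0"
proof -
  have null_0: "c = 0" if "lorentz c c = 0" "c $ 3 = 0" for c
    using that by (auto simp: lorentz_def vec_eq_iff forall_3 sum_squares_eq_zero_iff)
  have norm: "(cmod (Complex (c $ 1) (c $ 2)))\<^sup>2 = (c $ 3)\<^sup>2" if "lorentz c c = 0" for c
    using that unfolding cmod_power2 by (simp add: lorentz_def power2_eq_square)
  have unit: "cmod (Complex (c $ 1) (c $ 2) / of_real (c $ 3)) = 1"
    if "lorentz c c = 0" "c $ 3 \<noteq> 0" for c
  proof -
    have "cmod (Complex (c $ 1) (c $ 2)) = \<bar>c $ 3\<bar>"
      by (rule power2_eq_imp_eq) (simp_all add: norm[OF that(1)])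
    then show ?thesis
      using that by (simp add: norm_divide)
  qed
  have "(b $ 3 * a $ 1 - a $ 3 * b $ 1)\<^sup>2 + (b $ 3 * a $ 2 - a $ 3 * b $ 2)\<^sup>2
      = (b $ 3)\<^sup>2 * lorentz a a + (a $ 3)\<^sup>2 * lorentz b b - 2 * a $ 3 * b $ 3 * lorentz a b"
    unfolding lorentz_def by (simp add: power2_eq_square algebra_simps)
  then have parallel: "b $ 3 * a $ 1 = a $ 3 * b $ 1" "b $ 3 * a $ 2 = a $ 3 * b $ 2"
    using assms by (simp_all add: sum_power2_eq_zero_iff)
  show thesis
  proof (cases "a $ 3 = 0")
    case False
    then show ?thesis
      using that[OF unit[of a]] assms parallel by (simp add: complex_eq_iff field_simps)
  next
    case True
    then have "a = 0" "b $ 3 \<noteq> 0"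
      using assms null_0 by auto
    then show ?thesis
      using that[OF unit[of b]] assms by (simp add: complex_eq_iff)
  qed
qed

text \<open>
  The planar part of \<open>b\<close> is \<open>r w\<close> with \<open>r = b\<^sub>3\<close>, so the planar part of \<open>b'\<close> is \<open>r' w + r w'\<close>. The first summand is
  parallel to \<open>w\<close> and drops out of the cross product, which is therefore \<open>r\<^sup>2\<close> times that of \<open>w\<close>
  with \<open>w'\<close>. The latter vanishes only for \<open>w' = 0\<close>, because \<open>\<bar>w\<bar> = 1\<close> makes \<open>w'\<close> orthogonal to \<open>w\<close>.
\<close>

lemma rotating_vector_cross_nonzero_iff:
  fixes b :: "real \<Rightarrow> real^3" and w :: "real \<Rightarrow> complex"
  assumes bot: "at t within I \<noteq> bot" and t: "t \<in> I"
    and unit: "\<And>s. s \<in> I \<Longrightarrow> cmod (w s) = 1"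
    and b: "\<And>s. s \<in> I \<Longrightarrow> Complex (b s $ 1) (b s $ 2) = of_real (b s $ 3) * w s"
    and b': "(b has_vector_derivative b') (at t within I)"
    and w': "(w has_vector_derivative w') (at t within I)"
    and nz: "b t $ 3 \<noteq> 0"
  shows "b t $ 1 * b' $ 2 - b t $ 2 * b' $ 1 \<noteq> 0 \<longleftrightarrow> w' \<noteq> 0"
proof -
  have comp: "((\<lambda>s. b s $ k) has_vector_derivative b' $ k) (at t within I)" for k
    using bounded_linear.has_vector_derivative[OF bounded_linear_vec_nth b'] .
  have wR: "((\<lambda>s. Re (w s)) has_vector_derivative Re w') (at t within I)"
    and wI: "((\<lambda>s. Im (w s)) has_vector_derivative Im w') (at t within I)"
    using w' by (auto intro: bounded_linear.has_vector_derivative bounded_linear_Re bounded_linear_Im)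
  note D = comp[unfolded has_real_derivative_iff_has_vector_derivative[symmetric]]
    wR[unfolded has_real_derivative_iff_has_vector_derivative[symmetric]]
    wI[unfolded has_real_derivative_iff_has_vector_derivative[symmetric]]
  have uniq: "x = y" if "(f has_real_derivative x) (at t within I)"
    "(h has_real_derivative y) (at t within I)" "\<And>s. s \<in> I \<Longrightarrow> f s = h s" for f h x y
  proof -
    have "(f has_vector_derivative y) (at t within I)"
      using that t has_vector_derivative_transform
      by (metis has_real_derivative_iff_has_vector_derivative)
    then show ?thesis
      using that vector_derivative_unique_within[OF bot]
      by (metis has_real_derivative_iff_has_vector_derivative)
  qed
  have one: "Re (w s) * Re (w s) + Im (w s) * Im (w s) = 1" if "s \<in> I" for s
    using unit[OF that] by (metis cmod_power2 one_power2 power2_eq_square)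
  have orth: "Re w' * Re (w t) + Re w' * Re (w t) + (Im w' * Im (w t) + Im w' * Im (w t)) = 0"
    by (rule uniq[OF DERIV_add[OF DERIV_mult[OF D(2,2)] DERIV_mult[OF D(3,3)]] DERIV_const one])
  have val: "b s $ 1 = b s $ 3 * Re (w s)" "b s $ 2 = b s $ 3 * Im (w s)" if "s \<in> I" for s
    using b[OF that] by (simp_all add: complex_eq_iff)
  have b1: "b' $ 1 = b' $ 3 * Re (w t) + Re w' * b t $ 3"
    by (rule uniq[OF D(1) DERIV_mult[OF D(1,2)] val(1)])
  have b2: "b' $ 2 = b' $ 3 * Im (w t) + Im w' * b t $ 3"
    by (rule uniq[OF D(1) DERIV_mult[OF D(1,3)] val(2)])
  let ?cross = "Re (w t) * Im w' - Im (w t) * Re w'"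
  have "b t $ 1 * b' $ 2 - b t $ 2 * b' $ 1 = (b t $ 3)\<^sup>2 * ?cross"
    unfolding b1 b2 val[OF t] by algebra
  \<comment> \<open>Lagrange's identity for \<open>w\<close> and \<open>w'\<close>, whose inner product is zero by \<open>orth\<close>\<close>
  moreover have "?cross\<^sup>2 = (Re w')\<^sup>2 + (Im w')\<^sup>2"
    using orth one[OF t] by algebra
  then have "?cross = 0 \<longleftrightarrow> w' = 0"
    by (metis complex_eq_iff power_zero_numeral sum_power2_eq_zero_iff zero_complex.sel zero_eq_power2)
  ultimately show ?thesis
    using nz by simp
qed

section \<open>Characterization of shrinking singularities\<close>

text \<open>
  Derivatives within \<open>I\<close> are unique only at limit points of \<open>I\<close>; there the chosen one-sided or
  two-sided derivative agrees with the witness of smoothness.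
\<close>

lemma smooth_curve_derivative:
  assumes smooth: "smooth_curve_on I \<gamma>" and bot: "\<And>t. t \<in> I \<Longrightarrow> at t within I \<noteq> bot"
    and t: "t \<in> I"
  shows "(\<gamma> has_vector_derivative dcurve I \<gamma> t) (at t within I)"
    and "(dcurve I \<gamma> has_vector_derivative dcurve I (dcurve I \<gamma>) t) (at t within I)"
proof -
  obtain D where D: "D 0 = \<gamma>"
    "\<And>n t. t \<in> I \<Longrightarrow> (D n has_vector_derivative D (Suc n) t) (at t within I)"
    using smooth unfolding smooth_curve_on_def by blast
  have D1: "dcurve I \<gamma> s = D 1 s" if "s \<in> I" for s
    using vector_derivative_within[OF bot[OF that] D(2)[OF that, of 0]] by (simp add: dcurve_def D(1))
  show "(\<gamma> has_vector_derivative dcurve I \<gamma> t) (at t within I)"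
    using D(2)[OF t, of 0] D1[OF t] D(1) by simp
  have "(dcurve I \<gamma> has_vector_derivative D 2 t) (at t within I)"
    using has_vector_derivative_transform[OF t D1] D(2)[OF t, of 1] by (simp add: numeral_2_eq_2)
  then show "(dcurve I \<gamma> has_vector_derivative dcurve I (dcurve I \<gamma>) t) (at t within I)"
    using vector_derivative_within[OF bot[OF t]] unfolding dcurve_def[of I "dcurve I \<gamma>"] by metis
qed

theorem proposition3p1:
  fixes I :: "real set" and lam :: "real \<Rightarrow> complex" and \<alpha> \<beta> :: "real \<Rightarrow> real^3"
    and \<Omega> :: "complex set" and \<phi> :: "complex \<Rightarrow> complex^3" and t0 :: real
    and X :: "complex \<Rightarrow> real^3" and g :: "complex \<Rightarrow> complex"
  assumes data: "singular_bjorling_data I lam \<alpha> \<beta>"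
    and solution: "bjorling_solution I lam \<alpha> \<beta> \<Omega> \<phi> t0 X"
    and maxface: "maxface_on \<Omega> X g"
  shows "(shrinking_on_trace I lam X g \<longleftrightarrow>
      (\<forall>t\<in>I. dcurve I \<alpha> t $ 3 * Re (dcurve I lam t) + \<beta> t $ 3 * Im (dcurve I lam t) = 0) \<and>
      (\<forall>t\<in>I.
         (\<beta> t $ 3 \<noteq> 0 \<longrightarrow>
            \<beta> t $ 1 * dcurve I \<beta> t $ 2 - \<beta> t $ 2 * dcurve I \<beta> t $ 1 \<noteq> 0) \<and>
         (dcurve I \<alpha> t $ 3 \<noteq> 0 \<longrightarrow>
            dcurve I \<alpha> t $ 1 * dcurve I (dcurve I \<alpha>) t $ 2
              - dcurve I \<alpha> t $ 2 * dcurve I (dcurve I \<alpha>) t $ 1 \<noteq> 0)))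
    \<and> ((\<forall>t\<in>I. dcurve I \<alpha> t $ 3 * Re (dcurve I lam t) + \<beta> t $ 3 * Im (dcurve I lam t) = 0) \<and>
      (\<forall>t\<in>I.
         (\<beta> t $ 3 \<noteq> 0 \<longrightarrow>
            \<beta> t $ 1 * dcurve I \<beta> t $ 2 - \<beta> t $ 2 * dcurve I \<beta> t $ 1 \<noteq> 0) \<and>
         (dcurve I \<alpha> t $ 3 \<noteq> 0 \<longrightarrow>
            dcurve I \<alpha> t $ 1 * dcurve I (dcurve I \<alpha>) t $ 2
              - dcurve I \<alpha> t $ 2 * dcurve I (dcurve I \<alpha>) t $ 1 \<noteq> 0)) \<and>
      compact (lam ` I) \<and> lam ` I \<in> components (singular_points \<Omega> X)
      \<longrightarrow> (\<forall>p\<in>lam ` I. generalized_cone_like \<Omega> X p))"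
proof -
  let ?a = "dcurve I \<alpha>" and ?b = \<beta> and ?l' = "dcurve I lam"
  have interval: "is_interval I" and "interior I \<noteq> {}"
    and smooth: "smooth_curve_on I lam" "smooth_curve_on I \<alpha>" "smooth_curve_on I \<beta>"
    and l'_nz: "\<And>t. t \<in> I \<Longrightarrow> ?l' t \<noteq> 0"
    and null: "\<And>t. t \<in> I \<Longrightarrow> lorentz (?a t) (?a t) = 0" "\<And>t. t \<in> I \<Longrightarrow> lorentz (?b t) (?b t) = 0"
      "\<And>t. t \<in> I \<Longrightarrow> lorentz (?a t) (?b t) = 0" "\<And>t. t \<in> I \<Longrightarrow> ?a t \<noteq> 0 \<or> ?b t \<noteq> 0"
    using data by (auto simp: singular_bjorling_data_def)
  have dom: "open \<Omega>" "connected \<Omega>" and lam_in: "\<And>t. t \<in> I \<Longrightarrow> lam t \<in> \<Omega>"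
    and hol: "holomorphic_vec_on \<phi> \<Omega>" and t0: "t0 \<in> I"
    and prim: "is_Re_primitive \<Omega> \<phi> (lam t0) X"
    and \<phi>: "\<And>t k. t \<in> I \<Longrightarrow> \<phi> (lam t) $ k = of_real (?a t $ k) - \<i> * of_real (?b t $ k)"
    using solution
    by (auto simp: bjorling_solution_def extends_bjorling_data_def nbhd_domain_def)
  have bot: "at t within I \<noteq> bot" if "t \<in> I" for t
  proof -
    have "I \<noteq> {x}" for x
      using \<open>interior I \<noteq> {}\<close> by auto
    then show ?thesis
      using connected_imp_perfect[of I t] interval that
      by (auto simp: is_interval_connected trivial_limit_within)
  qed
  have D_lam: "(lam has_vector_derivative ?l' t) (at t within I)" if "t \<in> I" for t
    using smooth_curve_derivative(1)[OF smooth(1) bot] that by blast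
  have D_b: "(\<beta> has_vector_derivative dcurve I \<beta> t) (at t within I)" if "t \<in> I" for t
    using smooth_curve_derivative(1)[OF smooth(3) bot] that by blast
  have D_a: "(?a has_vector_derivative dcurve I ?a t) (at t within I)" if "t \<in> I" for t
    using smooth_curve_derivative(2)[OF smooth(2) bot] that by blast

  \<comment> \<open>the sign makes \<open>u t\<close> the planar direction of \<open>\<alpha>'\<close> and \<open>\<beta>\<close> rather than its negative\<close>
  define u where "u t = - g (lam t)" for t
  have direction: "cmod (u t) = 1 \<and> Complex (?a t $ 1) (?a t $ 2) = of_real (?a t $ 3) * u t
      \<and> Complex (?b t $ 1) (?b t $ 2) = of_real (?b t $ 3) * u t
      \<and> (?a t $ 3 \<noteq> 0 \<or> ?b t $ 3 \<noteq> 0) \<and> g analytic_on {lam t}" if t: "t \<in> I" for t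
  proof -
    obtain v where v: "cmod v = 1" "Complex (?a t $ 1) (?a t $ 2) = of_real (?a t $ 3) * v"
      "Complex (?b t $ 1) (?b t $ 2) = of_real (?b t $ 3) * v" "?a t $ 3 \<noteq> 0 \<or> ?b t $ 3 \<noteq> 0"
      using orthogonal_null_vectors_common_direction null[OF t] by metis
    \<comment> \<open>the scalar factor in \<open>\<phi> (lam t) = s (Re v, Im v, 1)\<close>\<close>
    define s where "s = complex_of_real (?a t $ 3) - \<i> * of_real (?b t $ 3)"
    have "s \<noteq> 0"
      using v(4) by (auto simp: s_def complex_eq_iff)
    have "v \<noteq> 0"
      using v(1) by auto
    have comps: "?a t $ 1 = ?a t $ 3 * Re v" "?a t $ 2 = ?a t $ 3 * Im v"
      "?b t $ 1 = ?b t $ 3 * Re v" "?b t $ 2 = ?b t $ 3 * Im v"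
      using v(2,3) by (simp_all add: complex_eq_iff)
    have F: "\<phi> (lam t) $ 1 - \<i> * \<phi> (lam t) $ 2 = s * cnj v"
      by (simp add: \<phi>[OF t] comps s_def complex_eq_iff algebra_simps)
    then have nz: "\<phi> (lam t) $ 1 - \<i> * \<phi> (lam t) $ 2 \<noteq> 0"
      using \<open>s \<noteq> 0\<close> \<open>v \<noteq> 0\<close> by simp
    note gauss = maxface_gauss_map[OF maxface hol prim lam_in[OF t0] lam_in[OF t] nz]
    have "\<phi> (lam t) $ 3 = s"
      by (simp add: \<phi>[OF t] s_def)
    then have "u t = s / (s * cnj v)"
      using gauss(2) unfolding F by (simp add: u_def)
    also have "\<dots> = v"
    proof -
      have "v * cnj v = 1"
        using v(1) by (simp add: complex_norm_square[symmetric])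
      then show ?thesis
        using \<open>s \<noteq> 0\<close> \<open>v \<noteq> 0\<close> by (simp add: field_simps)
    qed
    finally show ?thesis
      using v gauss(1) by simp
  qed

  let ?C1 = "\<forall>t\<in>I. ?a t $ 3 * Re (?l' t) + ?b t $ 3 * Im (?l' t) = 0"
  let ?C2 = "\<forall>t\<in>I. (?b t $ 3 \<noteq> 0 \<longrightarrow>
            ?b t $ 1 * dcurve I ?b t $ 2 - ?b t $ 2 * dcurve I ?b t $ 1 \<noteq> 0) \<and>
         (?a t $ 3 \<noteq> 0 \<longrightarrow>
            ?a t $ 1 * dcurve I ?a t $ 2 - ?a t $ 2 * dcurve I ?a t $ 1 \<noteq> 0)"

  have D_X: "((\<lambda>s. X (lam s) $ k) has_vector_derivative
      ?a t $ k * Re (?l' t) + ?b t $ k * Im (?l' t)) (at t within I)" if t: "t \<in> I" for t k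
  proof -
    have "((\<lambda>w. X w $ k) has_derivative (\<lambda>h. Re (\<phi> (lam t) $ k * h))) (at (lam t) within lam ` I)"
      using Re_primitive_has_derivative[OF dom lam_in[OF t0] hol prim lam_in[OF t]]
      by (rule has_derivative_at_withinI)
    from vector_derivative_diff_chain_within[OF D_lam[OF t] this] show ?thesis
      by (simp add: o_def \<phi>[OF t])
  qed
  have const_iff: "(\<exists>c. \<forall>t\<in>I. X (lam t) = c) \<longleftrightarrow> ?C1"
  proof
    assume "\<exists>c. \<forall>t\<in>I. X (lam t) = c"
    then obtain c where c: "\<And>t. t \<in> I \<Longrightarrow> X (lam t) = c"
      by blast
    show ?C1
    proof
      fix t assume t: "t \<in> I"
      have "((\<lambda>s. X (lam s) $ 3) has_vector_derivative 0) (at t within I)"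
        by (rule has_vector_derivative_transform[OF t _ has_vector_derivative_const[of "c $ 3"]])
          (simp add: c)
      then show "?a t $ 3 * Re (?l' t) + ?b t $ 3 * Im (?l' t) = 0"
        using vector_derivative_unique_within[OF bot[OF t] D_X[OF t]] by blast
    qed
  next
    assume C1: ?C1
    have "((\<lambda>s. X (lam s) $ k) has_vector_derivative 0) (at t within I)" if t: "t \<in> I" for t k
    proof -
      have "?a t $ 1 = ?a t $ 3 * Re (u t)" "?a t $ 2 = ?a t $ 3 * Im (u t)"
        "?b t $ 1 = ?b t $ 3 * Re (u t)" "?b t $ 2 = ?b t $ 3 * Im (u t)"
        using direction[OF t] by (simp_all add: complex_eq_iff)
      moreover have "?a t $ 3 * Re (?l' t) + ?b t $ 3 * Im (?l' t) = 0"
        using C1 t by blast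
      ultimately have "\<forall>k. ?a t $ k * Re (?l' t) + ?b t $ k * Im (?l' t) = 0"
        unfolding forall_3 by algebra
      then show ?thesis
        using D_X[OF t, of k] by simp
    qed
    then have "\<exists>c. \<forall>t\<in>I. X (lam t) $ k = c" for k
      using has_vector_derivative_zero_constant[of I "\<lambda>s. X (lam s) $ k"] interval
      by (metis is_interval_convex)
    then show "\<exists>c. \<forall>t\<in>I. X (lam t) = c"
      using t0 by (metis vec_eq_iff)
  qed

  have D_u: "(u has_vector_derivative - (?l' t * deriv g (lam t))) (at t within I)"
    if t: "t \<in> I" for t
  proof -
    have "(g has_field_derivative deriv g (lam t)) (at (lam t))"
      using direction[OF t] by (simp add: analytic_derivI)
    then have "(g has_field_derivative deriv g (lam t)) (at (lam t) within lam ` I)"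
      by (rule has_field_derivative_at_within)
    from field_vector_diff_chain_within[OF D_lam[OF t] this] show ?thesis
      unfolding u_def by (auto intro!: derivative_eq_intros simp: o_def)
  qed
  have deriv_iff: "(\<forall>t\<in>I. deriv g (lam t) \<noteq> 0) \<longleftrightarrow> ?C2"
  proof (rule ball_cong[OF refl])
    fix t assume t: "t \<in> I"
    have nz: "- (?l' t * deriv g (lam t)) \<noteq> 0 \<longleftrightarrow> deriv g (lam t) \<noteq> 0"
      using l'_nz[OF t] by simp
    have "?b t $ 1 * dcurve I ?b t $ 2 - ?b t $ 2 * dcurve I ?b t $ 1 \<noteq> 0
        \<longleftrightarrow> deriv g (lam t) \<noteq> 0" if "?b t $ 3 \<noteq> 0"
      using rotating_vector_cross_nonzero_iff[OF bot[OF t] t _ _ D_b[OF t] D_u[OF t] that]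
        direction nz by blast
    moreover have "?a t $ 1 * dcurve I ?a t $ 2 - ?a t $ 2 * dcurve I ?a t $ 1 \<noteq> 0
        \<longleftrightarrow> deriv g (lam t) \<noteq> 0" if "?a t $ 3 \<noteq> 0"
      using rotating_vector_cross_nonzero_iff[OF bot[OF t] t _ _ D_a[OF t] D_u[OF t] that]
        direction nz by blast
    ultimately show "deriv g (lam t) \<noteq> 0 \<longleftrightarrow> (?b t $ 3 \<noteq> 0 \<longrightarrow>
            ?b t $ 1 * dcurve I ?b t $ 2 - ?b t $ 2 * dcurve I ?b t $ 1 \<noteq> 0) \<and>
         (?a t $ 3 \<noteq> 0 \<longrightarrow>
            ?a t $ 1 * dcurve I ?a t $ 2 - ?a t $ 2 * dcurve I ?a t $ 1 \<noteq> 0)"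
      using direction[OF t] by blast
  qed

  have "shrinking_on_trace I lam X g \<longleftrightarrow> ?C1 \<and> ?C2"
    unfolding shrinking_on_trace_def const_iff deriv_iff ..
  moreover have "\<forall>p\<in>lam ` I. generalized_cone_like \<Omega> X p"
    if "?C1" "compact (lam ` I)" "lam ` I \<in> components (singular_points \<Omega> X)"
  proof -
    obtain c where "\<forall>t\<in>I. X (lam t) = c"
      using const_iff \<open>?C1\<close> by blast
    then have "X ` lam ` I = {c}"
      using t0 by force
    then show ?thesis
      using that unfolding generalized_cone_like_def by blast
  qed
  ultimately show ?thesis
    by blast
qed

end
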